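(* Let $(\mathfrak m,R)$ be a Lie triple system over $\mathbb K$ having a Jordan extension $T$, and let $(\varepsilon\mathfrak m,r,m)$ be the regular representation of $\mathfrak m$. Then there exists another representation $(\varepsilon\mathfrak m,\tilde r,\tilde m)$ of $\mathfrak m$ having the same $r$-component, i.e. $\tilde r=r$, and which is in general not isomorphic to the regular representation (that is, there are $(\mathfrak m,R)$ with Jordan extension $T$ for which $(\varepsilon\mathfrak m,\tilde r,\tilde m)$ is not isomorphic to $(\varepsilon\mathfrak m,r,m)$).
   Context: $\mathbb K$ is a (nonzero) commutative ring in which $2$ is invertible; all spaces are $\mathbb K$-modules. **Lie triple system.** A $\mathbb K$-module $\mathfrak m$ with a trilinear map $(X,Y,Z)\mapsto[X,Y,Z]=R(X,Y)Z$ such that (LT1) $R(X,Y)=-R(Y,X)$; (LT2) $R(X,Y)Z+R(Y,Z)X+R(Z,X)Y=0$; (LT3) each $R(X,Y)$ is a derivation of the triple product. **Representation ($\mathfrak m$-module).** A $\mathbb K$-module $V$ with bilinear maps $r,m:\mathfrak m\times\mathfrak m\to\mathrm{End}(V)$ such that $\mathfrak m\oplus V$ is a Lie triple system under $$[X\oplus u,Y\oplus v,Z\oplus w]=[X,Y,Z]\oplus\big(r(X,Y)w+m(X,Z)v-m(Y,Z)u\big).$$ Two representations are isomorphic if there is a linear isomorphism intertwining the $r$'s and the $m$'s. **Regular representation.** $V=\varepsilon\mathfrak m\cong\mathfrak m$ with $r(X,Y)=R(X,Y)$ and $m(X,Y)=M(X,Y)$, where $M(X,Z)Y:=[X,Y,Z]$.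 The corresponding Lie triple system $\mathfrak m\oplus\varepsilon\mathfrak m$ is the scalar extension of $\mathfrak m$ by the dual numbers $\mathbb K[\varepsilon]$, $\varepsilon^2=0$. **Jordan triple system.** A $\mathbb K$-module $\mathfrak m$ with a trilinear map $T:\mathfrak m^3\to\mathfrak m$ such that (JT1) $T(u,v,w)=T(w,v,u)$; (JT2) $T(u,v,T(x,y,z))=T(T(u,v,x),y,z)-T(x,T(v,u,y),z)+T(x,y,T(u,v,z))$. **Jordan extension.** A Jordan extension of a Lie triple system $(\mathfrak m,R)$ is a Jordan triple product $T$ on $\mathfrak m$ such that $R(X,Y)Z=T(X,Y,Z)-T(Y,X,Z)$. *)

theory Defs
  imports "HOL-Analysis.Product_Vector"
begin

definition trilinear ::
    "('k::comm_ring_1 \<Rightarrow> 'a::ab_group_add \<Rightarrow> 'a) \<Rightarrow> ('k \<Rightarrow> 'b::ab_group_add \<Rightarrow> 'b) \<Rightarrow>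
     ('k \<Rightarrow> 'c::ab_group_add \<Rightarrow> 'c) \<Rightarrow> ('k \<Rightarrow> 'd::ab_group_add \<Rightarrow> 'd) \<Rightarrow>
     ('a \<Rightarrow> 'b \<Rightarrow> 'c \<Rightarrow> 'd) \<Rightarrow> bool" where
  "trilinear s1 s2 s3 s4 f \<longleftrightarrow>
     (\<forall>y z. module_hom s1 s4 (\<lambda>x. f x y z)) \<and>
     (\<forall>x z. module_hom s2 s4 (\<lambda>y. f x y z)) \<and>
     (\<forall>x y. module_hom s3 s4 (\<lambda>z. f x y z))"

locale lie_triple_system = module s
  for s :: "'k::comm_ring_1 \<Rightarrow> 'm::ab_group_add \<Rightarrow> 'm" +
  fixes R :: "'m \<Rightarrow> 'm \<Rightarrow> 'm \<Rightarrow> 'm"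
  assumes R_trilinear: "trilinear s s s s R"
    and LT1: "R X Y Z = - R Y X Z"
    and LT2: "R X Y Z + R Y Z X + R Z X Y = 0"
    and LT3: "R X Y (R U V W) = R (R X Y U) V W + R U (R X Y V) W + R U V (R X Y W)"

text \<open>A bilinear map \<open>r : \<mm> \<times> \<mm> \<rightarrow> End V\<close> is encoded as the curried trilinear map
  \<open>(X, Y, v) \<mapsto> r(X,Y)v\<close>.\<close>

fun split_bracket ::
    "('m \<Rightarrow> 'm \<Rightarrow> 'm \<Rightarrow> 'm) \<Rightarrow> ('m \<Rightarrow> 'm \<Rightarrow> 'v \<Rightarrow> 'v::ab_group_add) \<Rightarrow> ('m \<Rightarrow> 'm \<Rightarrow> 'v \<Rightarrow> 'v) \<Rightarrow>
     'm \<times> 'v \<Rightarrow> 'm \<times> 'v \<Rightarrow> 'm \<times> 'v \<Rightarrow> 'm \<times> 'v" where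
  "split_bracket R r m (X, u) (Y, v) (Z, w) = (R X Y Z, r X Y w + m X Z v - m Y Z u)"

locale lts_representation = lie_triple_system s R + V: module sV
  for s :: "'k::comm_ring_1 \<Rightarrow> 'm::ab_group_add \<Rightarrow> 'm"
    and R :: "'m \<Rightarrow> 'm \<Rightarrow> 'm \<Rightarrow> 'm"
    and sV :: "'k \<Rightarrow> 'v::ab_group_add \<Rightarrow> 'v" +
  fixes r :: "'m \<Rightarrow> 'm \<Rightarrow> 'v \<Rightarrow> 'v"
    and m :: "'m \<Rightarrow> 'm \<Rightarrow> 'v \<Rightarrow> 'v"
  assumes r_trilinear: "trilinear s s sV sV r"
    and m_trilinear: "trilinear s s sV sV m"
    and split_lts: "lie_triple_system (module_prod.scale s sV) (split_bracket R r m)"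

definition lts_rep_isomorphic ::
    "('k::comm_ring_1 \<Rightarrow> 'v::ab_group_add \<Rightarrow> 'v) \<Rightarrow> ('m \<Rightarrow> 'm \<Rightarrow> 'v \<Rightarrow> 'v) \<Rightarrow> ('m \<Rightarrow> 'm \<Rightarrow> 'v \<Rightarrow> 'v) \<Rightarrow>
     ('k \<Rightarrow> 'w::ab_group_add \<Rightarrow> 'w) \<Rightarrow> ('m \<Rightarrow> 'm \<Rightarrow> 'w \<Rightarrow> 'w) \<Rightarrow> ('m \<Rightarrow> 'm \<Rightarrow> 'w \<Rightarrow> 'w) \<Rightarrow> bool" where
  "lts_rep_isomorphic sV r m sW r' m' \<longleftrightarrow>
     (\<exists>f. module_hom sV sW f \<and> bij f \<and>
        (\<forall>X Y v. f (r X Y v) = r' X Y (f v)) \<and>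
        (\<forall>X Y v. f (m X Y v) = m' X Y (f v)))"

text \<open>The module \<open>\<epsilon>\<mm>\<close> of the regular representation is identified with \<open>\<mm>\<close>.\<close>

definition regular_r :: "('m \<Rightarrow> 'm \<Rightarrow> 'm \<Rightarrow> 'm) \<Rightarrow> 'm \<Rightarrow> 'm \<Rightarrow> 'm \<Rightarrow> 'm" where
  "regular_r R X Y v = R X Y v"

definition regular_m :: "('m \<Rightarrow> 'm \<Rightarrow> 'm \<Rightarrow> 'm) \<Rightarrow> 'm \<Rightarrow> 'm \<Rightarrow> 'm \<Rightarrow> 'm" where
  "regular_m R X Z v = R X v Z"

locale jordan_triple_system = module s
  for s :: "'k::comm_ring_1 \<Rightarrow> 'm::ab_group_add \<Rightarrow> 'm" +
  fixes T :: "'m \<Rightarrow> 'm \<Rightarrow> 'm \<Rightarrow> 'm"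
  assumes T_trilinear: "trilinear s s s s T"
    and JT1: "T u v w = T w v u"
    and JT2: "T u v (T x y z) = T (T u v x) y z - T x (T v u y) z + T x y (T u v z)"

definition jordan_extension ::
    "('k::comm_ring_1 \<Rightarrow> 'm::ab_group_add \<Rightarrow> 'm) \<Rightarrow> ('m \<Rightarrow> 'm \<Rightarrow> 'm \<Rightarrow> 'm) \<Rightarrow>
     ('m \<Rightarrow> 'm \<Rightarrow> 'm \<Rightarrow> 'm) \<Rightarrow> bool" where
  "jordan_extension s R T \<longleftrightarrow>
     jordan_triple_system s T \<and> (\<forall>X Y Z. R X Y Z = T X Y Z - T Y X Z)"

text \<open>The second representation attached to a Jordan triple product \<open>T\<close>.  Extend \<open>T\<close> trilinearly
  over the dual numbers to \<open>\<mm> \<oplus> \<epsilon>\<mm>\<close> and twist its middle argument by the conjugation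
  \<open>\<tau>(X + \<epsilon>u) = X - \<epsilon>u\<close>.  The result \<open>(a,b,c) \<mapsto> T(a, \<tau> b, c)\<close> is again a Jordan triple product,
  and its Lie triple bracket \<open>T(a, \<tau> b, c) - T(b, \<tau> a, c)\<close> is
  \<open>[X,Y,Z] + \<epsilon>(r(X,Y)w + m(X,Z)v - m(Y,Z)u)\<close> with the following \<open>r\<close> and \<open>m\<close>.  Without the twist one
  gets the regular representation, with \<open>m(X,Z)v = T(X,v,Z) - T(v,X,Z)\<close>.\<close>

definition twisted_r :: "('m::ab_group_add \<Rightarrow> 'm \<Rightarrow> 'm \<Rightarrow> 'm) \<Rightarrow> 'm \<Rightarrow> 'm \<Rightarrow> 'm \<Rightarrow> 'm" where
  "twisted_r T X Y w = T X Y w - T Y X w"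

definition twisted_m :: "('m::ab_group_add \<Rightarrow> 'm \<Rightarrow> 'm \<Rightarrow> 'm) \<Rightarrow> 'm \<Rightarrow> 'm \<Rightarrow> 'm \<Rightarrow> 'm" where
  "twisted_m T X Z v = - T X v Z - T v X Z"

end

theory Submission
  imports Defs
begin

text \<open>A Jordan triple product \<open>T\<close> yields Lie triple systems by antisymmetrizing its first two
  arguments, \<open>[X,Y,Z] = T(X,Y,Z) - T(Y,X,Z)\<close>: the defining identity of \<open>T\<close> says that
  \<open>D(u,v) = T(u,v,\<cdot>)\<close> is a derivation up to exchanging \<open>u\<close> and \<open>v\<close> in the middle slot, so
  \<open>D(u,v) - D(v,u)\<close> is a genuine derivation (\<open>lie_triple_of_jordan_triple\<close>).

  Two operations produce further Jordan products. Extending scalars to the dual numbers turns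
  \<open>T\<close> into a Jordan product on \<open>\<mm> \<oplus> \<epsilon>\<mm>\<close> (\<open>jordan_dual_extension\<close>), and composing the
  middle argument of a Jordan product with an involutive automorphism gives a Jordan product
  again (\<open>jordan_middle_twist\<close>). Conjugation \<open>X + \<epsilon>u \<mapsto> X - \<epsilon>u\<close> is such an automorphism. The Lie
  triple bracket of the product twisted by it is exactly the split bracket of \<open>twisted_r T\<close> and
  \<open>twisted_m T\<close> (\<open>split_bracket_twisted\<close>), so these form a representation. The conjugation
  changes the sign of an \<open>\<epsilon>\<close>-component in the middle slot of \<open>T\<close>, but that of an
  \<open>\<epsilon>\<close>-component in the third slot is untouched; this is why \<open>r\<close> stays the same while \<open>m\<close>
  changes.

  The two representations differ already for \<open>T(x,y,z) = xyz\<close> on the ground ring: commutativity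
  makes the bracket, hence the regular \<open>m\<close>, vanish, whereas the twisted \<open>m(X,Z)\<close> is
  multiplication by \<open>-2XZ\<close>, which is nonzero for \<open>X = Z = 1\<close> because \<open>2\<close> is a unit of a nonzero
  ring.\<close>

section \<open>Trilinear maps\<close>

lemma module_homI:
  assumes "module s" "module t"
    and "\<And>x y. f (x + y) = f x + f y"
    and "\<And>c x. f (s c x) = t c (f x)"
  shows "module_hom s t f"
  using assms by (simp add: module_hom_iff)

lemma trilinearI:
  assumes "module s1" "module s2" "module s3" "module s4"
    and "\<And>x x' y z. f (x + x') y z = f x y z + f x' y z"
    and "\<And>x y y' z. f x (y + y') z = f x y z + f x y' z"
    and "\<And>x y z z'. f x y (z + z') = f x y z + f x y z'"
    and "\<And>c x y z. f (s1 c x) y z = s4 c (f x y z)"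
    and "\<And>c x y z. f x (s2 c y) z = s4 c (f x y z)"
    and "\<And>c x y z. f x y (s3 c z) = s4 c (f x y z)"
  shows "trilinear s1 s2 s3 s4 f"
  unfolding trilinear_def using assms by (auto intro!: module_homI)

lemma
  assumes "trilinear s1 s2 s3 s4 f"
  shows trilinear_add1: "f (x + x') y z = f x y z + f x' y z"
    and trilinear_add2: "f x (y + y') z = f x y z + f x y' z"
    and trilinear_add3: "f x y (z + z') = f x y z + f x y z'"
    and trilinear_diff1: "f (x - x') y z = f x y z - f x' y z"
    and trilinear_diff2: "f x (y - y') z = f x y z - f x y' z"
    and trilinear_diff3: "f x y (z - z') = f x y z - f x y z'"
    and trilinear_minus1: "f (- x) y z = - f x y z"
    and trilinear_minus2: "f x (- y) z = - f x y z"
    and trilinear_minus3: "f x y (- z) = - f x y z"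
    and trilinear_scale1: "f (s1 c x) y z = s4 c (f x y z)"
    and trilinear_scale2: "f x (s2 c y) z = s4 c (f x y z)"
    and trilinear_scale3: "f x y (s3 c z) = s4 c (f x y z)"
proof -
  interpret h1: module_hom s1 s4 "\<lambda>x. f x y z" for y z using assms by (simp add: trilinear_def)
  interpret h2: module_hom s2 s4 "\<lambda>y. f x y z" for x z using assms by (simp add: trilinear_def)
  interpret h3: module_hom s3 s4 "\<lambda>z. f x y z" for x y using assms by (simp add: trilinear_def)
  show "f (x + x') y z = f x y z + f x' y z" by (rule h1.add)
  show "f x (y + y') z = f x y z + f x y' z" by (rule h2.add)
  show "f x y (z + z') = f x y z + f x y z'" by (rule h3.add)
  show "f (x - x') y z = f x y z - f x' y z" by (rule h1.diff)
  show "f x (y - y') z = f x y z - f x y' z" by (rule h2.diff)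
  show "f x y (z - z') = f x y z - f x y z'" by (rule h3.diff)
  show "f (- x) y z = - f x y z" by (rule h1.neg)
  show "f x (- y) z = - f x y z" by (rule h2.neg)
  show "f x y (- z) = - f x y z" by (rule h3.neg)
  show "f (s1 c x) y z = s4 c (f x y z)" by (rule h1.scale)
  show "f x (s2 c y) z = s4 c (f x y z)" by (rule h2.scale)
  show "f x y (s3 c z) = s4 c (f x y z)" by (rule h3.scale)
qed

section \<open>From Jordan triple systems to Lie triple systems\<close>

definition jordan_bracket ::
    "('m::ab_group_add \<Rightarrow> 'm \<Rightarrow> 'm \<Rightarrow> 'm) \<Rightarrow> 'm \<Rightarrow> 'm \<Rightarrow> 'm \<Rightarrow> 'm" where
  "jordan_bracket T X Y Z = T X Y Z - T Y X Z"

context jordan_triple_system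
begin

lemmas T_add = trilinear_add1[OF T_trilinear] trilinear_add2[OF T_trilinear]
  trilinear_add3[OF T_trilinear]
lemmas T_diff = trilinear_diff1[OF T_trilinear] trilinear_diff2[OF T_trilinear]
  trilinear_diff3[OF T_trilinear]
lemmas T_minus = trilinear_minus1[OF T_trilinear] trilinear_minus2[OF T_trilinear]
  trilinear_minus3[OF T_trilinear]
lemmas T_scale = trilinear_scale1[OF T_trilinear] trilinear_scale2[OF T_trilinear]
  trilinear_scale3[OF T_trilinear]

text \<open>In (JT2) the operator \<open>T(u,v,\<cdot>)\<close> acts on the outer arguments and \<open>-T(v,u,\<cdot>)\<close> on the
  middle one. Subtracting the same identity with \<open>u\<close> and \<open>v\<close> exchanged makes the action on all
  three arguments the same.\<close>

lemma jordan_bracket_derivation: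
  "jordan_bracket T u v (T x y z) =
     T (jordan_bracket T u v x) y z + T x (jordan_bracket T u v y) z
     + T x y (jordan_bracket T u v z)"
  unfolding jordan_bracket_def JT2[of u v x y z] JT2[of v u x y z]
  by (simp add: T_diff)

lemma lie_triple_of_jordan_triple: "lie_triple_system s (jordan_bracket T)"
proof (unfold_locales)
  show "trilinear s s s s (jordan_bracket T)"
    by (rule trilinearI)
      (simp_all add: module_axioms jordan_bracket_def T_add T_scale scale_right_diff_distrib)
  show "jordan_bracket T X Y Z = - jordan_bracket T Y X Z" for X Y Z
    by (simp add: jordan_bracket_def)
  show "jordan_bracket T X Y Z + jordan_bracket T Y Z X + jordan_bracket T Z X Y = 0" for X Y Z
    unfolding jordan_bracket_def JT1[of X Y Z] JT1[of Y Z X] JT1[of Z X Y] by simp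
  show "jordan_bracket T X Y (jordan_bracket T U V W) =
      jordan_bracket T (jordan_bracket T X Y U) V W + jordan_bracket T U (jordan_bracket T X Y V) W
      + jordan_bracket T U V (jordan_bracket T X Y W)" for X Y U V W
  proof -
    let ?D = "jordan_bracket T X Y"
    have "?D (T U V W - T V U W) = ?D (T U V W) - ?D (T V U W)"
      by (simp add: jordan_bracket_def T_diff)
    then show ?thesis
      by (simp only: jordan_bracket_derivation jordan_bracket_def[of T U V]
          jordan_bracket_def[of T "?D U"] jordan_bracket_def[of T U "?D V"]) simp
  qed
qed

end

section \<open>New Jordan triple systems from old\<close>

context jordan_triple_system
begin

text \<open>The middle slot of (JT2) contains \<open>T(v, \<tau>u, y)\<close> under one more \<open>\<tau>\<close>; moving that \<open>\<tau>\<close>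
  inwards produces \<open>T(\<tau>v, \<tau>\<tau>u, \<tau>y)\<close>, and \<open>\<tau>\<tau>u = u\<close> is what (JT2) for \<open>T\<close> requires.\<close>

lemma jordan_middle_twist:
  assumes hom: "module_hom s s \<tau>"
    and aut: "\<And>x y z. \<tau> (T x y z) = T (\<tau> x) (\<tau> y) (\<tau> z)"
    and invol: "\<And>x. \<tau> (\<tau> x) = x"
  shows "jordan_triple_system s (\<lambda>x y z. T x (\<tau> y) z)"
proof -
  interpret \<tau>: module_hom s s \<tau> by (rule hom)
  show ?thesis
  proof (unfold_locales)
    show "trilinear s s s s (\<lambda>x y z. T x (\<tau> y) z)"
      by (rule trilinearI) (simp_all add: module_axioms T_add T_scale \<tau>.add \<tau>.scale)
    show "T u (\<tau> v) w = T w (\<tau> v) u" for u v w by (rule JT1)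
    show "T u (\<tau> v) (T x (\<tau> y) z) =
        T (T u (\<tau> v) x) (\<tau> y) z - T x (\<tau> (T v (\<tau> u) y)) z + T x (\<tau> y) (T u (\<tau> v) z)"
      for u v x y z
      unfolding aut invol by (rule JT2)
  qed
qed

end

text \<open>A pair \<open>(X, u)\<close> stands for \<open>X + \<epsilon>u\<close>, and the second component is the Leibniz rule that
  results from \<open>\<epsilon>\<^sup>2 = 0\<close>.\<close>

fun dual_extension ::
    "('m \<Rightarrow> 'm \<Rightarrow> 'm \<Rightarrow> 'm::ab_group_add) \<Rightarrow> 'm \<times> 'm \<Rightarrow> 'm \<times> 'm \<Rightarrow> 'm \<times> 'm \<Rightarrow> 'm \<times> 'm" where
  "dual_extension T (X, u) (Y, v) (Z, w) = (T X Y Z, T u Y Z + T X v Z + T X Y w)"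

definition dual_conj :: "'m \<times> 'm \<Rightarrow> 'm \<times> 'm::ab_group_add" where
  "dual_conj p = (fst p, - snd p)"

context jordan_triple_system
begin

sublocale dual: module_prod s s ..

lemma jordan_dual_extension: "jordan_triple_system dual.scale (dual_extension T)"
proof (unfold_locales)
  show "trilinear dual.scale dual.scale dual.scale dual.scale (dual_extension T)"
    by (rule trilinearI)
      (auto simp: dual.p.module_axioms dual.scale_def T_add T_scale scale_right_distrib)
  show "dual_extension T p q t = dual_extension T t q p" for p q t
    by (cases p; cases q; cases t) (simp add: JT1)
  show "dual_extension T p q (dual_extension T a b c) =
      dual_extension T (dual_extension T p q a) b c - dual_extension T a (dual_extension T q p b) c
      + dual_extension T a b (dual_extension T p q c)" for p q a b c
  proof -
    obtain P p' Q q' A a' B b' C c'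
      where pairs: "p = (P, p')" "q = (Q, q')" "a = (A, a')" "b = (B, b')" "c = (C, c')"
      by (cases p, cases q, cases a, cases b, cases c) auto
    \<comment> \<open>(JT2) on \<open>\<mm>\<close>, and once for each position at which the \<open>\<epsilon>\<close>-component can enter\<close>
    show ?thesis
      by (simp add: pairs T_add JT2[of P Q A B C] JT2[of p' Q A B C] JT2[of P q' A B C]
          JT2[of P Q a' B C] JT2[of P Q A b' C] JT2[of P Q A B c'])
  qed
qed

lemma dual_conj_hom: "module_hom dual.scale dual.scale dual_conj"
  by (rule module_homI) (auto simp: dual.p.module_axioms dual_conj_def dual.scale_def)

lemma dual_conj_automorphism:
  "dual_conj (dual_extension T p q t)
     = dual_extension T (dual_conj p) (dual_conj q) (dual_conj t)"
  by (cases p; cases q; cases t) (simp add: dual_conj_def T_minus)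

end

section \<open>The twisted representation\<close>

lemma twisted_r_eq_jordan_bracket: "twisted_r T = jordan_bracket T"
  by (simp add: fun_eq_iff twisted_r_def jordan_bracket_def)

context jordan_triple_system
begin

text \<open>In \<open>T(X, \<tau>q, Z) - T(q, \<tau>X, Z)\<close> with \<open>q = \<epsilon>v\<close> only the first term picks up a sign, so the
  two terms have equal signs and combine to \<open>m(X,Z)v = -T(X,v,Z) - T(v,X,Z)\<close>.\<close>

lemma split_bracket_twisted:
  "split_bracket (jordan_bracket T) (twisted_r T) (twisted_m T)
     = jordan_bracket (\<lambda>p q t. dual_extension T p (dual_conj q) t)"
  by (auto simp: fun_eq_iff twisted_r_def twisted_m_def jordan_bracket_def dual_conj_def T_minus)

lemma twisted_representation:
  "lts_representation s (jordan_bracket T) s (twisted_r T) (twisted_m T)"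
proof -
  interpret lie: lie_triple_system s "jordan_bracket T" by (rule lie_triple_of_jordan_triple)
  interpret ext: jordan_triple_system dual.scale "dual_extension T"
    by (rule jordan_dual_extension)
  interpret twist: jordan_triple_system dual.scale "\<lambda>p q t. dual_extension T p (dual_conj q) t"
    by (rule ext.jordan_middle_twist[OF dual_conj_hom dual_conj_automorphism])
      (simp add: dual_conj_def)
  show ?thesis
  proof (intro lts_representation.intro lts_representation_axioms.intro)
    show "lie_triple_system s (jordan_bracket T)" ..
    show "module s" ..
    show "trilinear s s s s (twisted_r T)"
      unfolding twisted_r_eq_jordan_bracket by (rule lie.R_trilinear)
    show "trilinear s s s s (twisted_m T)"
      by (rule trilinearI)
        (simp_all add: module_axioms twisted_m_def T_add T_scale scale_right_diff_distrib)
    show "lie_triple_system dual.scale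
        (split_bracket (jordan_bracket T) (twisted_r T) (twisted_m T))"
      unfolding split_bracket_twisted by (rule twist.lie_triple_of_jordan_triple)
  qed
qed

end

lemma jordan_extension_twisted_representation:
  assumes "jordan_extension s R T"
  shows "lts_representation s R s (twisted_r T) (twisted_m T)" "twisted_r T = regular_r R"
proof -
  have "jordan_triple_system s T" and R: "R = jordan_bracket T"
    using assms by (auto simp: jordan_extension_def fun_eq_iff jordan_bracket_def)
  then interpret jordan_triple_system s T by simp
  show "lts_representation s R s (twisted_r T) (twisted_m T)"
    unfolding R by (rule twisted_representation)
  show "twisted_r T = regular_r R"
    by (simp add: fun_eq_iff R twisted_r_eq_jordan_bracket regular_r_def)
qed

section \<open>The ground ring as a counterexample to isomorphism\<close>

lemma jordan_triple_system_ring: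
  "jordan_triple_system (*) (\<lambda>x y z :: 'k::comm_ring_1. x * y * z)"
proof -
  have mod: "module ((*) :: 'k \<Rightarrow> 'k \<Rightarrow> 'k)"
    by unfold_locales (simp_all add: algebra_simps)
  show ?thesis
  proof (intro jordan_triple_system.intro jordan_triple_system_axioms.intro)
    show "trilinear (*) (*) (*) (*) (\<lambda>x y z :: 'k. x * y * z)"
      by (rule trilinearI) (simp_all add: mod algebra_simps)
  qed (simp_all add: mod algebra_simps)
qed

lemma jordan_extension_ring:
  "jordan_extension (*) (\<lambda>_ _ _. 0) (\<lambda>x y z :: 'k::comm_ring_1. x * y * z)"
  using jordan_triple_system_ring by (simp add: jordan_extension_def)

text \<open>An isomorphism would intertwine \<open>m(1,1) = -2\<close> with \<open>0\<close>, and injectivity would give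
  \<open>2 = 0\<close>.\<close>

lemma ring_twisted_not_isomorphic_regular:
  assumes "(2::'k::comm_ring_1) \<noteq> 0"
  shows "\<not> lts_rep_isomorphic ((*) :: 'k \<Rightarrow> 'k \<Rightarrow> 'k)
           r (twisted_m (\<lambda>x y z. x * y * z)) (*) r' (regular_m (\<lambda>_ _ _. 0))"
proof
  assume "lts_rep_isomorphic ((*) :: 'k \<Rightarrow> 'k \<Rightarrow> 'k)
           r (twisted_m (\<lambda>x y z. x * y * z)) (*) r' (regular_m (\<lambda>_ _ _. 0))"
  then obtain f :: "'k \<Rightarrow> 'k" where hom: "module_hom (*) (*) f" and "inj f"
    and m: "\<And>X Y v. f (twisted_m (\<lambda>x y z. x * y * z) X Y v) = regular_m (\<lambda>_ _ _. 0) X Y (f v)"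
    unfolding lts_rep_isomorphic_def by (auto dest: bij_is_inj)
  have "f (- 2) = 0"
    using m[of 1 1 1] by (simp add: twisted_m_def regular_m_def)
  also have "0 = f 0"
    using module_hom.zero[OF hom] by simp
  finally have "- 2 = (0::'k)"
    using \<open>inj f\<close> by (simp only: inj_eq)
  then show False
    using assms by simp
qed

section \<open>Representations with the same first component\<close>

theorem theorem6p5:
  fixes s :: "'k::comm_ring_1 \<Rightarrow> 'm::ab_group_add \<Rightarrow> 'm"
    and R T :: "'m \<Rightarrow> 'm \<Rightarrow> 'm \<Rightarrow> 'm"
  assumes two_invertible: "(2::'k) dvd 1"
    and lts: "lie_triple_system s R"
    and ext: "jordan_extension s R T"
  shows "(lts_representation s R s (twisted_r T) (twisted_m T) \<and> twisted_r T = regular_r R) \<and>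
         (\<exists>(s\<^sub>0 :: 'k \<Rightarrow> 'k \<Rightarrow> 'k) R\<^sub>0 T\<^sub>0.
            lie_triple_system s\<^sub>0 R\<^sub>0 \<and> jordan_extension s\<^sub>0 R\<^sub>0 T\<^sub>0 \<and>
            lts_representation s\<^sub>0 R\<^sub>0 s\<^sub>0 (twisted_r T\<^sub>0) (twisted_m T\<^sub>0) \<and>
            twisted_r T\<^sub>0 = regular_r R\<^sub>0 \<and>
            \<not> lts_rep_isomorphic s\<^sub>0 (twisted_r T\<^sub>0) (twisted_m T\<^sub>0)
                 s\<^sub>0 (regular_r R\<^sub>0) (regular_m R\<^sub>0))"
proof
  show "lts_representation s R s (twisted_r T) (twisted_m T) \<and> twisted_r T = regular_r R"
    using jordan_extension_twisted_representation[OF ext] by simp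
  have "(2::'k) \<noteq> 0"
    using two_invertible by auto
  let ?R = "\<lambda>_ _ _. 0 :: 'k" and ?T = "\<lambda>x y z :: 'k. x * y * z"
  have rep: "lts_representation (*) ?R (*) (twisted_r ?T) (twisted_m ?T)"
    and r: "twisted_r ?T = regular_r ?R"
    by (rule jordan_extension_twisted_representation[OF jordan_extension_ring])+
  have "lie_triple_system (*) ?R"
    using rep by (simp add: lts_representation_def)
  with rep r show "\<exists>(s\<^sub>0 :: 'k \<Rightarrow> 'k \<Rightarrow> 'k) R\<^sub>0 T\<^sub>0.
            lie_triple_system s\<^sub>0 R\<^sub>0 \<and> jordan_extension s\<^sub>0 R\<^sub>0 T\<^sub>0 \<and>
            lts_representation s\<^sub>0 R\<^sub>0 s\<^sub>0 (twisted_r T\<^sub>0) (twisted_m T\<^sub>0) \<and>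
            twisted_r T\<^sub>0 = regular_r R\<^sub>0 \<and>
            \<not> lts_rep_isomorphic s\<^sub>0 (twisted_r T\<^sub>0) (twisted_m T\<^sub>0)
                 s\<^sub>0 (regular_r R\<^sub>0) (regular_m R\<^sub>0)"
    using jordan_extension_ring ring_twisted_not_isomorphic_regular[OF \<open>(2::'k) \<noteq> 0\<close>] by blast
qed

end
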